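(* Let $X$ be a Banach space which has $C(\omega^\omega)$ as a quotient space. Then $X$ is not uniformly homeomorphic to $c_0$.
   Context: $C(\omega^\omega)$ is the Banach space of continuous scalar functions, with the sup norm, on the compact space of all ordinals $\le\omega^\omega$ in the order topology. $X$ has $Z$ as a quotient space if there is a bounded linear operator from $X$ onto $Z$. Two Banach spaces are uniformly homeomorphic if there is a bijection $U$ between them such that both $U$ and $U^{-1}$ are uniformly continuous. *)

theory Defs
  imports "HOL-Analysis.Analysis" "HOL-Library.Multiset_Order"
begin

section \<open>The compact space of ordinals up to \<open>\<omega>\<^sup>\<omega>\<close>\<close>

text \<open>
  An ordinal below \<open>\<omega>\<^sup>\<omega>\<close> is given by its Cantor normal form, a finite sum of terms
  \<open>\<omega>\<^sup>k \<cdot> count M k\<close> in decreasing order of the exponents \<open>k\<close>. Cantor normal forms are compared at the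
  largest exponent where the coefficients differ. The order type is checked below.
\<close>

datatype ordww = CNF "nat multiset" | Omega_omega

instantiation ordww :: linorder
begin

definition less_ordww :: "ordww \<Rightarrow> ordww \<Rightarrow> bool" where
  "\<alpha> < \<beta> \<longleftrightarrow> (case (\<alpha>, \<beta>) of
     (CNF M, CNF N) \<Rightarrow> \<exists>k. count M k < count N k \<and> (\<forall>j>k. count M j = count N j)
   | (CNF M, Omega_omega) \<Rightarrow> True
   | (Omega_omega, _) \<Rightarrow> False)"

definition less_eq_ordww :: "ordww \<Rightarrow> ordww \<Rightarrow> bool" where
  "\<alpha> \<le> \<beta> \<longleftrightarrow> \<alpha> < \<beta> \<or> \<alpha> = (\<beta> :: ordww)"

lemma less_multiset_iff_lex:
  fixes M N :: "nat multiset"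
  shows "M < N \<longleftrightarrow> (\<exists>k. count M k < count N k \<and> (\<forall>j>k. count M j = count N j))"
proof
  assume less: "M < N"
  define D where "D = {j. count M j \<noteq> count N j}"
  have "D \<subseteq> set_mset M \<union> set_mset N"
    unfolding D_def by (auto simp flip: count_greater_zero_iff)
  then have fin: "finite D"
    by (rule finite_subset) simp
  have "D \<noteq> {}"
    using less multiset_eqI[of M N] unfolding D_def by blast
  define k where "k = Max D"
  have k: "k \<in> D"
    unfolding k_def using fin \<open>D \<noteq> {}\<close> by (rule Max_in)
  have eq: "count M j = count N j" if "j > k" for j
  proof (rule ccontr)
    assume "count M j \<noteq> count N j"
    then have "j \<le> k"
      unfolding k_def using fin by (intro Max_ge) (auto simp: D_def)
    with that show False by simp
  qed
  have "\<not> count N k < count M k"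
  proof
    assume "count N k < count M k"
    then obtain j where "j > k" "count M j < count N j"
      using less unfolding less_multiset\<^sub>H\<^sub>O by blast
    with eq[of j] show False by simp
  qed
  with k have "count M k < count N k"
    unfolding D_def by auto
  with eq show "\<exists>k. count M k < count N k \<and> (\<forall>j>k. count M j = count N j)"
    by blast
next
  assume "\<exists>k. count M k < count N k \<and> (\<forall>j>k. count M j = count N j)"
  then obtain k where k: "count M k < count N k" "\<And>j. j > k \<Longrightarrow> count M j = count N j"
    by blast
  have "\<exists>x>y. count M x < count N x" if "count N y < count M y" for y
  proof -
    have "y < k"
      using that k(1) k(2)[of y] by (cases y k rule: linorder_cases) auto
    with k(1) show ?thesis by blast
  qed
  moreover have "M \<noteq> N"
    using k(1) by blast
  ultimately show "M < N"
    unfolding less_multiset\<^sub>H\<^sub>O by blast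
qed

lemma less_ordww_simps [simp]:
  "CNF M < CNF N \<longleftrightarrow> M < N"
  "CNF M < Omega_omega"
  "\<not> Omega_omega < \<alpha>"
  by (simp_all add: less_ordww_def less_multiset_iff_lex split: ordww.split)

lemma less_eq_ordww_simps [simp]:
  "CNF M \<le> CNF N \<longleftrightarrow> M \<le> N"
  "\<alpha> \<le> Omega_omega"
  "\<not> Omega_omega \<le> CNF M"
  by (cases \<alpha>; auto simp: less_eq_ordww_def)+

instance
proof
  fix x y z :: ordww
  show "x < y \<longleftrightarrow> x \<le> y \<and> \<not> y \<le> x"
    by (cases x; cases y) auto
  show "x \<le> x"
    by (simp add: less_eq_ordww_def)
  show "x \<le> z" if "x \<le> y" "y \<le> z"
    using that by (cases x; cases y; cases z) auto
  show "x = y" if "x \<le> y" "y \<le> x"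
    using that by (cases x; cases y) auto
  show "x \<le> y \<or> y \<le> x"
    by (cases x; cases y) auto
qed

end

instance ordww :: wellorder
proof
  fix P :: "ordww \<Rightarrow> bool" and \<alpha>
  assume step: "\<And>\<alpha>. (\<And>\<beta>. \<beta> < \<alpha> \<Longrightarrow> P \<beta>) \<Longrightarrow> P \<alpha>"
  have CNF: "P (CNF M)" for M
  proof (induction M rule: less_induct)
    case (less M)
    show ?case
    proof (rule step)
      fix \<beta> assume "\<beta> < CNF M"
      then show "P \<beta>" using less by (cases \<beta>) auto
    qed
  qed
  have "P Omega_omega"
  proof (rule step)
    fix \<beta> assume "\<beta> < Omega_omega"
    then show "P \<beta>" using CNF by (cases \<beta>) auto
  qed
  with CNF show "P \<alpha>" by (cases \<alpha>) auto
qed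

text \<open>
  The next four lemmas identify \<open>CNF {#k#}\<close> as \<open>\<omega>\<^sup>k\<close> and \<open>Omega_omega\<close> as \<open>\<omega>\<^sup>\<omega>\<close>:
  \<open>\<omega>\<^sup>0 = 1\<close>, \<open>\<omega>\<^bsup>k+1\<^esup> = \<omega>\<^sup>k \<cdot> \<omega>\<close> (that is, \<open>\<omega>\<close> consecutive copies of \<open>\<omega>\<^sup>k\<close>) and
  \<open>\<omega>\<^sup>\<omega> = sup\<^sub>k \<omega>\<^sup>k\<close>.
\<close>

lemma less_omega_power_iff: "CNF M < CNF {#k#} \<longleftrightarrow> (\<forall>j\<in>#M. j < k)"
proof
  assume "CNF M < CNF {#k#}"
  then obtain i where i: "count M i < count {#k#} i" "\<And>j. j > i \<Longrightarrow> count M j = count {#k#} j"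
    by (auto simp: less_multiset_iff_lex)
  then have ik: "i = k" by (auto split: if_splits)
  show "\<forall>j\<in>#M. j < k"
  proof
    fix j assume "j \<in># M"
    show "j < k"
    proof (rule ccontr)
      assume "\<not> j < k"
      then consider "j = k" | "j > k" by linarith
      then have "count M j = 0"
        using i(1) i(2)[of j] unfolding ik by cases simp_all
      with \<open>j \<in># M\<close> show False by (metis not_in_iff)
    qed
  qed
next
  assume "\<forall>j\<in>#M. j < k"
  then have "count M j = 0" if "j \<ge> k" for j
    using that by (meson leD not_in_iff)
  then show "CNF M < CNF {#k#}"
    by (auto simp: less_multiset_iff_lex intro!: exI[of _ k])
qed

lemma omega_power_0: "{..<CNF {#0#}} = {CNF {#}}"
proof -
  have "\<alpha> < CNF {#0#} \<longleftrightarrow> \<alpha> = CNF {#}" for \<alpha>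
  proof (cases \<alpha>)
    case (CNF M)
    have "CNF M < CNF {#0#} \<longleftrightarrow> set_mset M = {}"
      by (auto simp only: less_omega_power_iff)
    with CNF show ?thesis by simp
  qed simp
  then show ?thesis by auto
qed

lemma omega_power_Suc:
  fixes k :: nat
  defines "f \<equiv> \<lambda>(n, M). CNF (replicate_mset n k + M)"
  defines "A \<equiv> (UNIV :: nat set) \<times> {M. CNF M < CNF {#k#}}"
  shows "bij_betw f A {..<CNF {#Suc k#}}"
    and "\<And>n M n' M'. (n, M) \<in> A \<Longrightarrow> (n', M') \<in> A \<Longrightarrow>
           f (n, M) < f (n', M') \<longleftrightarrow> n < n' \<or> n = n' \<and> CNF M < CNF M'"
proof -
  have A: "(n, M) \<in> A \<longleftrightarrow> (\<forall>j\<in>#M. j < k)" for n M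
    unfolding A_def by (simp only: mem_Times_iff mem_Collect_eq less_omega_power_iff) simp
  have cnt: "count M j = 0" if "(n, M) \<in> A" "j \<ge> k" for n M j
    using that unfolding A by (meson leD not_in_iff)
  have lt: "f (n, M) < f (n', M')" if "(n, M) \<in> A" "(n', M') \<in> A" "n < n'" for n M n' M'
    using that cnt[OF that(1)] cnt[OF that(2)]
    by (auto simp: f_def less_multiset_iff_lex intro!: exI[of _ k])
  show *: "f (n, M) < f (n', M') \<longleftrightarrow> n < n' \<or> n = n' \<and> CNF M < CNF M'"
    if "(n, M) \<in> A" "(n', M') \<in> A" for n M n' M'
  proof (cases n n' rule: linorder_cases)
    case less
    then show ?thesis using lt that by blast
  next
    case equal
    then show ?thesis by (simp add: f_def)
  next
    case greater
    then show ?thesis using lt[OF that(2,1)] by auto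
  qed
  have "inj_on f A"
  proof (rule inj_onI, clarify)
    fix n M n' M'
    assume h: "(n, M) \<in> A" "(n', M') \<in> A" "f (n, M) = f (n', M')"
    then have "n = n'"
      using lt[OF h(1,2)] lt[OF h(2,1)] by (cases n n' rule: linorder_cases) auto
    with h(3) show "n = n' \<and> M = M'" by (simp add: f_def)
  qed
  moreover have "f ` A = {..<CNF {#Suc k#}}"
  proof (intro equalityI subsetI)
    fix \<alpha> assume "\<alpha> \<in> f ` A"
    then obtain n M where nM: "(n, M) \<in> A" "\<alpha> = CNF (replicate_mset n k + M)"
      by (auto simp: f_def)
    then have "\<forall>j\<in>#replicate_mset n k + M. j < Suc k"
      unfolding A by (auto split: if_splits simp: less_Suc_eq)
    then show "\<alpha> \<in> {..<CNF {#Suc k#}}"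
      unfolding nM(2) by (simp only: lessThan_iff less_omega_power_iff)
  next
    fix \<alpha> assume \<alpha>: "\<alpha> \<in> {..<CNF {#Suc k#}}"
    then obtain N where N: "\<alpha> = CNF N" by (cases \<alpha>) auto
    have le: "\<forall>j\<in>#N. j < Suc k"
      using \<alpha> unfolding N by (simp only: lessThan_iff less_omega_power_iff)
    define M where "M = filter_mset (\<lambda>j. j \<noteq> k) N"
    have "(count N k, M) \<in> A"
      unfolding A M_def using le by (auto simp: less_Suc_eq)
    moreover have "N = replicate_mset (count N k) k + M"
      unfolding M_def by (auto simp: multiset_eq_iff)
    ultimately show "\<alpha> \<in> f ` A"
      unfolding N f_def by force
  qed
  ultimately show "bij_betw f A {..<CNF {#Suc k#}}"
    by (simp add: bij_betw_def)
qed

lemma less_Omega_omega_iff: "\<alpha> < Omega_omega \<longleftrightarrow> (\<exists>k. \<alpha> < CNF {#k#})"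
proof (cases \<alpha>)
  case (CNF M)
  have "\<forall>j\<in>#M. j < Suc (Max (set_mset M))"
    by (auto simp: less_Suc_eq_le)
  then have "CNF M < CNF {#Suc (Max (set_mset M))#}"
    by (simp only: less_omega_power_iff)
  with CNF show ?thesis by auto
qed auto

instantiation ordww :: linorder_topology
begin

definition open_ordww :: "ordww set \<Rightarrow> bool" where
  "open_ordww = generate_topology (range (\<lambda>a. {..<a}) \<union> range (\<lambda>a. {a<..}))"

instance by standard (rule open_ordww_def)

end

lemma compact_atMost_wellorder: "compact {..a}" for a :: "'a::{linorder_topology,wellorder}"
proof (induction a rule: less_induct)
  case (less a)
  show ?case
  proof (rule compactI)
    fix C :: "'a set set"
    assume op: "\<forall>t\<in>C. open t" and cover: "{..a} \<subseteq> \<Union>C"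
    then obtain U where U: "U \<in> C" "a \<in> U" "open U" by blast
    show "\<exists>C'. C' \<subseteq> C \<and> finite C' \<and> {..a} \<subseteq> \<Union>C'"
    proof (cases "\<exists>y. y < a")
      case False
      then have "{..a} \<subseteq> \<Union>{U}"
        using U by (auto simp: le_less)
      with U show ?thesis by (intro exI[of _ "{U}"]) auto
    next
      case True
      then obtain b where b: "b < a" "{b<..a} \<subseteq> U"
        using open_left[OF U(3,2)] by blast
      have "{..b} \<subseteq> {..a}"
        using b(1) by simp
      with cover have cov: "{..b} \<subseteq> \<Union>C"
        by (rule subset_trans[rotated])
      have "compact {..b}"
        using b(1) by (rule less.IH)
      then obtain D where "D \<subseteq> C" "finite D" "{..b} \<subseteq> \<Union>D"
        using cov op by (elim compactE) auto
      moreover have "{..a} \<subseteq> {..b} \<union> {b<..a}"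
        by auto
      with b(2) \<open>{..b} \<subseteq> \<Union>D\<close> have "{..a} \<subseteq> \<Union>(insert U D)"
        by blast
      ultimately show ?thesis
        using U by (intro exI[of _ "insert U D"]) auto
    qed
  qed
qed

lemma compact_UNIV_ordww: "compact (UNIV :: ordww set)"
proof -
  have "(UNIV :: ordww set) = {..Omega_omega}" by auto
  then show ?thesis using compact_atMost_wellorder by metis
qed

text \<open>
  Hence the library type of bounded continuous functions, with its supremum norm,
  contains all continuous functions on \<open>ordww\<close>.
\<close>

lemma continuous_on_ordww_bcontfun:
  fixes f :: "ordww \<Rightarrow> 'b::metric_space"
  assumes "continuous_on UNIV f"
  shows "f \<in> bcontfun"
  using assms compact_continuous_image[OF assms compact_UNIV_ordww]
  by (simp add: bcontfun_def compact_imp_bounded)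

section \<open>Normed spaces over the scalar field, quotients and uniform homeomorphisms\<close>

text \<open>
  The scalar field is a type of sort \<open>{real_normed_field, euclidean_space}\<close>; up to isometric
  isomorphism these are exactly \<open>\<real>\<close> and \<open>\<complex>\<close>. A normed space over it is a real
  normed space with a compatible scalar multiplication.
\<close>

locale normed_space_over = vector_space scale
  for scale :: "'k::{real_normed_field,euclidean_space} \<Rightarrow> 'a::real_normed_vector \<Rightarrow> 'a" +
  assumes scale_of_real: "scale (of_real r) x = r *\<^sub>R x"
    and norm_scale: "norm (scale c x) = norm c * norm x"

lemma normed_space_over_scaleR:
  "normed_space_over (scaleR :: real \<Rightarrow> 'a::real_normed_vector \<Rightarrow> 'a)"
  by unfold_locales (simp_all add: algebra_simps)

definition scale_bcontfun ::
    "'k::{real_normed_field,euclidean_space} \<Rightarrow> ('b::topological_space \<Rightarrow>\<^sub>C 'k) \<Rightarrow> ('b \<Rightarrow>\<^sub>C 'k)" where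
  "scale_bcontfun c f = Bcontfun (\<lambda>x. c * apply_bcontfun f x)"

lemma apply_scale_bcontfun: "apply_bcontfun (scale_bcontfun c f) x = c * apply_bcontfun f x"
proof -
  have "bounded ((\<lambda>y. c * y) ` range (apply_bcontfun f))"
    by (intro bounded_linear_image bounded_linear_mult_right bounded_apply_bcontfun)
  then have "(\<lambda>x. c * apply_bcontfun f x) \<in> bcontfun"
    by (auto simp: bcontfun_def image_image intro!: continuous_intros)
  then show ?thesis by (simp add: scale_bcontfun_def Bcontfun_inverse)
qed

lemma normed_space_over_scale_bcontfun:
  "normed_space_over (scale_bcontfun ::
     'k::{real_normed_field,euclidean_space} \<Rightarrow> ('b::topological_space \<Rightarrow>\<^sub>C 'k) \<Rightarrow> ('b \<Rightarrow>\<^sub>C 'k))"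
proof unfold_locales
  fix c d :: 'k and f g :: "'b \<Rightarrow>\<^sub>C 'k" and r :: real
  show "scale_bcontfun c (f + g) = scale_bcontfun c f + scale_bcontfun c g"
    by (rule bcontfun_eqI) (simp add: apply_scale_bcontfun algebra_simps)
  show "scale_bcontfun (c + d) f = scale_bcontfun c f + scale_bcontfun d f"
    by (rule bcontfun_eqI) (simp add: apply_scale_bcontfun algebra_simps)
  show "scale_bcontfun c (scale_bcontfun d f) = scale_bcontfun (c * d) f"
    by (rule bcontfun_eqI) (simp add: apply_scale_bcontfun algebra_simps)
  show "scale_bcontfun 1 f = f"
    by (rule bcontfun_eqI) (simp add: apply_scale_bcontfun)
  show "scale_bcontfun (of_real r) f = r *\<^sub>R f"
    by (rule bcontfun_eqI) (simp add: apply_scale_bcontfun scaleR_conv_of_real)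
  have le: "norm (scale_bcontfun c f) \<le> norm c * norm f" for c :: 'k and f :: "'b \<Rightarrow>\<^sub>C 'k"
    by (rule norm_bound) (simp add: apply_scale_bcontfun norm_mult mult_left_mono norm_bounded)
  show "norm (scale_bcontfun c f) = norm c * norm f"
  proof (cases "c = 0")
    case True
    then show ?thesis using le[of 0 f] by simp
  next
    case False
    have "scale_bcontfun (inverse c) (scale_bcontfun c f) = f"
      by (rule bcontfun_eqI) (simp add: apply_scale_bcontfun False flip: mult.assoc)
    then have "norm f \<le> inverse (norm c) * norm (scale_bcontfun c f)"
      using le[of "inverse c" "scale_bcontfun c f"] by (simp add: norm_inverse)
    then have "norm c * norm f \<le> norm (scale_bcontfun c f)"
      using False by (simp add: field_simps)
    with le[of c f] show ?thesis by simp
  qed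
qed

definition has_quotient_space ::
    "('k::{real_normed_field,euclidean_space} \<Rightarrow> 'a::real_normed_vector \<Rightarrow> 'a) \<Rightarrow>
     ('k \<Rightarrow> 'b::real_normed_vector \<Rightarrow> 'b) \<Rightarrow> bool" where
  "has_quotient_space scaleX scaleZ \<longleftrightarrow>
     (\<exists>T. bounded_linear T \<and> Vector_Spaces.linear scaleX scaleZ T \<and> surj T)"

text \<open>The space \<open>c\<^sub>0\<close> as a subspace of \<open>\<ell>\<^sub>\<infinity>\<close> (\<open>nat\<close> carries the discrete topology).\<close>

definition c0 :: "(nat \<Rightarrow>\<^sub>C 'k::{real_normed_field,euclidean_space}) set" where
  "c0 = {x. apply_bcontfun x \<longlonglongrightarrow> 0}"

lemma tendsto_0_imp_c0:
  fixes f :: "nat \<Rightarrow> 'k::{real_normed_field,euclidean_space}"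
  assumes "f \<longlonglongrightarrow> 0"
  shows "\<exists>x\<in>c0. apply_bcontfun x = f"
proof -
  have "f \<in> bcontfun"
    using convergent_imp_bounded[OF assms] by (simp add: bcontfun_def continuous_on_discrete)
  then show ?thesis
    using assms by (metis (mono_tags, lifting) Bcontfun_inverse c0_def mem_Collect_eq)
qed

definition uniformly_homeomorphic :: "'a::metric_space set \<Rightarrow> 'b::metric_space set \<Rightarrow> bool" where
  "uniformly_homeomorphic S T \<longleftrightarrow>
     (\<exists>U. bij_betw U S T \<and> uniformly_continuous_on S U \<and>
          uniformly_continuous_on T (inv_into S U))"

end

theory Submission
  imports Defs
begin

text \<open>
  Suppose \<open>U\<close> is a uniform homeomorphism from \<open>X\<close> onto \<open>c\<^sub>0\<close> with inverse \<open>V\<close>, and let \<open>T\<close> map \<open>X\<close> onto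
  \<open>C(\<omega>\<^sup>\<omega>)\<close>. The contradiction comes from measuring how steep the point evaluations
  \<open>f\<^sub>\<beta> v = T (V v) \<beta>\<close> are as functions on \<open>c\<^sub>0\<close>. Since \<open>T \<circ> V\<close> is uniformly continuous on a
  convex set, it is Lipschitz at distances \<open>\<ge> 1\<close>, so the slopes of the \<open>f\<^sub>\<beta>\<close> at scales \<open>t \<ge> 1\<close>
  are bounded by a common constant. On the other hand the slope essentially increases by a fixed amount
  whenever one moves from an ordinal \<open>\<alpha>\<close> to any other ordinal close to it. As \<open>\<omega>\<^sup>N\<close> has
  Cantor-Bendixson rank \<open>N\<close>, one can move in this way \<open>N\<close> times in a row, for every \<open>N\<close>.

  The increase of the slope combines two facts. One is the geometry of \<open>c\<^sub>0\<close>: if \<open>u\<close> and \<open>v\<close> have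
  midpoint \<open>w\<close> and distance \<open>2 s\<close>, then \<open>w + z\<close> is still almost a metric midpoint whenever
  \<open>\<parallel>z\<parallel> \<le> s\<close> and the first coordinates of \<open>z\<close> are small. The other is the Gorelik principle, a
  consequence of Brouwer's theorem, which needs \<open>U\<close> to be defined on the whole of \<open>X\<close>: every
  \<open>y\<close> in \<open>X\<close> of norm at most a multiple of \<open>s\<close> is a difference \<open>V (w + z) - V (w + a)\<close>, where \<open>z\<close> is
  as above and \<open>a\<close> comes from a finite set that does not depend on \<open>y\<close>. Take \<open>u, v\<close> that
  almost realise the slope of \<open>f\<^sub>\<alpha>\<close>, take \<open>\<beta> \<noteq> \<alpha>\<close> so close to \<open>\<alpha>\<close> that \<open>f\<^sub>\<alpha>\<close> and \<open>f\<^sub>\<beta>\<close>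
  almost agree on \<open>v\<close> and the finitely many \<open>w + a\<close>, and take \<open>y\<close> with \<open>T y\<close> close to a
  function that vanishes at \<open>\<alpha>\<close> and is as large as possible at \<open>\<beta>\<close>. Then \<open>f\<^sub>\<beta>\<close> exceeds \<open>f\<^sub>\<alpha>\<close> at the almost-midpoint
  \<open>w + z\<close> by a multiple of \<open>s\<close>, and hence is steeper between \<open>v\<close> and \<open>w + z\<close>
  (lemma \<open>slope_growth\<close>).

  Passing to the midpoint halves the scale, so for the slopes \<open>S\<^sub>\<beta>\<close> this argument only bounds
  \<open>S\<^sub>\<beta> t\<close> below by \<open>2 S\<^sub>\<alpha> (2 t) - S\<^sub>\<alpha> t\<close>, instead of \<open>S\<^sub>\<alpha> t\<close>, plus a constant gain. The quantity
  that really increases is therefore the sum of the slopes over many dyadic scales, where the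
  differences \<open>2 (S\<^sub>\<alpha> (2 t) - S\<^sub>\<alpha> t)\<close> telescope and cost only a bounded amount
  (lemma \<open>no_gorelik_map_into_continuous_functions_on_ordww\<close>).
\<close>

section \<open>Uniformly continuous maps at large distances and approximate lifts\<close>

text \<open>
  A segment of length \<open>r\<close> splits into about \<open>r / \<delta>\<close> pieces of length less than \<open>\<delta>\<close>, on each of which
  the map moves by less than \<open>1\<close>.
\<close>

lemma uniformly_continuous_on_convex_imp_large_scale_lipschitz:
  fixes f :: "'a::real_normed_vector \<Rightarrow> 'b::metric_space"
  assumes "convex S" "uniformly_continuous_on S f"
  obtains C where "C > 0"
    "\<And>x y. x \<in> S \<Longrightarrow> y \<in> S \<Longrightarrow> dist (f x) (f y) \<le> C * max 1 (dist x y)"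
proof -
  obtain \<delta> where \<delta>: "\<delta> > 0" "\<And>x y. x \<in> S \<Longrightarrow> y \<in> S \<Longrightarrow> dist x y < \<delta> \<Longrightarrow> dist (f x) (f y) < 1"
    using assms(2) unfolding uniformly_continuous_on_def by (metis zero_less_one)
  have bound: "dist (f x) (f y) \<le> (1 / \<delta> + 2) * max 1 (dist x y)" if xy: "x \<in> S" "y \<in> S" for x y
  proof -
    define n where "n = nat \<lceil>dist x y / \<delta>\<rceil> + 1"
    define p where "p i = (1 - real i / real n) *\<^sub>R x + (real i / real n) *\<^sub>R y" for i
    have n: "real n > dist x y / \<delta>" "real n \<le> dist x y / \<delta> + 2" "n > 0"
      using \<delta>(1) zero_le_dist[of x y] unfolding n_def by (auto simp: le_nat_iff) linarith+
    have pS: "p i \<in> S" if "i \<le> n" for i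
      unfolding p_def using that n(3) xy by (intro convexD_alt[OF assms(1)]) auto
    have step: "dist (p i) (p (Suc i)) < \<delta>" for i
    proof -
      have "p (Suc i) - p i = (1 / real n) *\<^sub>R (y - x)"
        unfolding p_def by (simp add: algebra_simps add_divide_distrib)
      then have "dist (p i) (p (Suc i)) = dist x y / real n"
        by (metis dist_commute dist_norm norm_scaleR abs_of_nonneg divide_nonneg_nonneg of_nat_0_le_iff
            zero_le_one times_divide_eq_left mult_1)
      moreover have "dist x y / real n < \<delta>" using n \<delta>(1) by (simp add: field_simps)
      ultimately show ?thesis by simp
    qed
    have "dist (f (p 0)) (f (p i)) \<le> real i" if "i \<le> n" for i
      using that
    proof (induction i)
      case (Suc i)
      have "dist (f (p i)) (f (p (Suc i))) < 1"
        using \<delta>(2) pS step Suc.prems by simp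
      with Suc dist_triangle[of "f (p 0)" "f (p (Suc i))" "f (p i)"] show ?case by simp
    qed simp
    from this[of n] have "dist (f x) (f y) \<le> real n"
      using n(3) by (simp add: p_def)
    also have "\<dots> \<le> dist x y / \<delta> + 2" by (rule n)
    also have "\<dots> \<le> max 1 (dist x y) / \<delta> + 2 * max 1 (dist x y)"
      using \<delta>(1) by (intro add_mono divide_right_mono) auto
    finally show ?thesis by (simp add: algebra_simps)
  qed
  show ?thesis
    using \<delta>(1) bound by (intro that[of "1 / \<delta> + 2"]) (auto simp: add_pos_pos)
qed

text \<open>
  The domain is an arbitrary topological space because \<open>ordww\<close> carries an order topology and no
  metric.
\<close>

lemma complete_UNIV_bcontfun:
  "complete (UNIV :: ('b::topological_space \<Rightarrow>\<^sub>C 'c::complete_space) set)"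
  unfolding complete_def
proof (intro allI impI, elim conjE)
  fix f :: "nat \<Rightarrow> 'b \<Rightarrow>\<^sub>C 'c"
  assume "Cauchy f"
  then have "\<forall>e>0. \<exists>N. \<forall>m n x. N \<le> m \<and> N \<le> n \<and> True \<longrightarrow> dist (apply_bcontfun (f m) x) (apply_bcontfun (f n) x) < e"
    unfolding Cauchy_def by (meson dist_fun_lt_imp_dist_val_lt)
  then obtain l where "\<forall>e>0. \<exists>N. \<forall>n x. N \<le> n \<and> True \<longrightarrow> dist (apply_bcontfun (f n) x) (l x) < e"
    unfolding uniformly_convergent_eq_cauchy[symmetric] by blast
  then have "uniform_limit UNIV f l sequentially"
    by (simp add: uniform_limit_sequentially_iff)
  then obtain l' where "f \<longlonglongrightarrow> l'"
    using uniform_limit_bcontfunE[OF _ sequentially_bot] by metis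
  then show "\<exists>l\<in>UNIV. f \<longlonglongrightarrow> l" by blast
qed

text \<open>
  The part of the open mapping theorem that follows from Baire's theorem in the codomain alone;
  the exact lift would require a further summation, and approximate lifts suffice below.
\<close>

lemma surj_bounded_linear_approx_lift:
  fixes T :: "'a::real_normed_vector \<Rightarrow> 'b::real_normed_vector"
  assumes "bounded_linear T" "surj T" and complete: "complete (UNIV :: 'b set)"
  obtains Q where "Q > 0"
    "\<And>z \<delta>. \<delta> > 0 \<Longrightarrow> \<exists>y. norm y \<le> Q * norm z \<and> norm (T y - z) \<le> \<delta>"
proof -
  interpret bounded_linear T by fact
  define A where "A n = closure (T ` cball 0 (real n))" for n
  have cover: "\<Union> (range A) = UNIV"
  proof -
    have "z \<in> \<Union> (range A)" for z
    proof -
      obtain x where "z = T x" using assms(2) by (metis surjD)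
      moreover obtain n where "norm x \<le> real n" using real_arch_simple by blast
      ultimately have "z \<in> A n" unfolding A_def using closure_subset by fastforce
      then show ?thesis by blast
    qed
    then show ?thesis by blast
  qed
  obtain n where "interior (A n) \<noteq> {}"
  proof (rule ccontr)
    assume "\<not> thesis"
    then have "interior (A n) = {}" for n using that by blast
    moreover have "completely_metrizable_space (euclidean :: 'b topology)"
      using Met_TC.completely_metrizable_space_mtopology complete by auto
    ultimately have "euclidean interior_of \<Union> (range A) = {}"
      by (intro Baire_category_alt) (auto simp: A_def)
    then show False unfolding cover by simp
  qed
  then obtain z0 r where r: "r > 0" "ball z0 r \<subseteq> A n"
    by (meson ex_in_conv mem_interior)
  have small: "\<exists>y. norm y \<le> 2 * real n \<and> norm (T y - z) \<le> \<delta>" if z: "norm z < r" and \<delta>: "\<delta> > 0" for z \<delta>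
  proof -
    have "z0 + z \<in> A n" "z0 \<in> A n"
      using r z by (auto simp: dist_norm)
    then obtain x1 x2 where x: "norm x1 \<le> real n" "norm x2 \<le> real n"
        "dist (T x1) (z0 + z) < \<delta> / 2" "dist (T x2) z0 < \<delta> / 2"
      using half_gt_zero[OF \<delta>] unfolding A_def closure_approachable
      by (metis (no_types, lifting) imageE mem_cball_0)
    have eq: "T (x1 - x2) - z = (T x1 - (z0 + z)) - (T x2 - z0)"
      by (simp add: diff)
    have "norm (T (x1 - x2) - z) \<le> \<delta>"
      unfolding eq using x(3,4) norm_triangle_ineq4[of "T x1 - (z0 + z)" "T x2 - z0"] by (simp add: dist_norm)
    moreover have "norm (x1 - x2) \<le> 2 * real n"
      using x(1,2) norm_triangle_ineq4[of x1 x2] by simp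
    ultimately show ?thesis by blast
  qed
  show ?thesis
  proof (rule that[of "4 * real n / r + 1"])
    show "4 * real n / r + 1 > 0" using r(1) by (simp add: add_nonneg_pos)
    fix z :: 'b and \<delta> :: real assume "\<delta> > 0"
    show "\<exists>y. norm y \<le> (4 * real n / r + 1) * norm z \<and> norm (T y - z) \<le> \<delta>"
    proof (cases "z = 0")
      case True
      then show ?thesis using \<open>\<delta> > 0\<close> by (intro exI[of _ 0]) (simp add: zero)
    next
      case False
      define c where "c = r / (2 * norm z)"
      have c: "c > 0" using False r(1) by (simp add: c_def)
      obtain y where y: "norm y \<le> 2 * real n" "norm (T y - c *\<^sub>R z) \<le> c * \<delta>"
        using small[of "c *\<^sub>R z" "c * \<delta>"] False r(1) c \<open>\<delta> > 0\<close> by (auto simp: c_def)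
      have eq: "T (y /\<^sub>R c) - z = (T y - c *\<^sub>R z) /\<^sub>R c"
        using c by (simp add: scaleR algebra_simps)
      have "norm (T (y /\<^sub>R c) - z) \<le> \<delta>"
        unfolding eq norm_scaleR using y(2) c by (simp add: field_simps)
      moreover have "norm (y /\<^sub>R c) \<le> (4 * real n / r + 1) * norm z"
      proof -
        have "norm (y /\<^sub>R c) \<le> 2 * real n / c"
          using y(1) c by (simp add: field_simps)
        also have "\<dots> = 4 * real n / r * norm z"
          using r(1) by (simp add: c_def field_simps)
        also have "\<dots> \<le> (4 * real n / r + 1) * norm z"
          by (intro mult_right_mono) auto
        finally show ?thesis .
      qed
      ultimately show ?thesis by blast
    qed
  qed
qed

section \<open>Near-zeros of maps on a cube grid\<close>

text \<open>
  A discrete form of the Poincare-Miranda theorem (equivalent to Brouwer's theorem), obtained from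
  Kuhn's lemma by labelling grid points with the signs of the coordinates of \<open>g\<close>. It has two
  features that are used later: the dimension is the size of a finite index set instead of a type,
  and the near-zero lies on a finite grid that can be fixed before \<open>g\<close> is known.
\<close>

lemma grid_map_near_zero:
  fixes g :: "('i \<Rightarrow> nat) \<Rightarrow> 'i \<Rightarrow> real"
  defines "N \<equiv> \<lambda>I p. PiE I (\<lambda>_. {..p})"
  assumes fin: "finite I" and p: "p > 0"
    and low: "\<And>q i. q \<in> N I p \<Longrightarrow> i \<in> I \<Longrightarrow> q i = 0 \<Longrightarrow> g q i \<le> 0"
    and high: "\<And>q i. q \<in> N I p \<Longrightarrow> i \<in> I \<Longrightarrow> q i = p \<Longrightarrow> 0 \<le> g q i"
    and osc: "\<And>q r i. q \<in> N I p \<Longrightarrow> r \<in> N I p \<Longrightarrow> (\<forall>j\<in>I. q j \<le> r j \<and> r j \<le> q j + 1) \<Longrightarrow> i \<in> I \<Longrightarrow>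
                 \<bar>g q i - g r i\<bar> \<le> \<eta>"
  shows "\<exists>q\<in>N I p. \<forall>i\<in>I. \<bar>g q i\<bar> \<le> \<eta>"
proof -
  define m where "m = card I"
  obtain e where e: "bij_betw e {0..<m} I"
    using ex_bij_betw_nat_finite[OF fin] unfolding m_def by blast
  define e' where "e' = inv_into {0..<m} e"
  have e': "e' i < m" "e (e' i) = i" if "i \<in> I" for i
    using that e bij_betw_imp_surj_on[OF e] f_inv_into_f[of i e "{0..<m}"] inv_into_into[of i e "{0..<m}"]
    by (auto simp: e'_def)
  have e_inv: "e i \<in> I" "e' (e i) = i" if "i < m" for i
    using that bij_betwE[OF e] bij_betw_inv_into_left[OF e] by (auto simp: e'_def)
  define P where "P x = (\<lambda>i\<in>I. x (e' i))" for x :: "nat \<Rightarrow> nat"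
  have P: "P x \<in> N I p" if "\<forall>i<m. x i \<le> p" for x
    using that e' by (auto simp: P_def N_def)
  have Pe: "P x (e i) = x i" if "i < m" for x i
    using that e_inv by (simp add: P_def)
  define label :: "(nat \<Rightarrow> nat) \<Rightarrow> nat \<Rightarrow> nat" where
    "label x i = (if x i = 0 then 0 else if x i = p then 1 else if g (P x) (e i) > 0 then 1 else 0)" for x i
  obtain q where q: "\<forall>i<m. q i < p"
    and q_cell: "\<forall>i<m. \<exists>r s. (\<forall>j<m. q j \<le> r j \<and> r j \<le> q j + 1) \<and>
                   (\<forall>j<m. q j \<le> s j \<and> s j \<le> q j + 1) \<and> label r i \<noteq> label s i"
    by (rule kuhn_lemma[of p m label]) (use p in \<open>auto simp: label_def\<close>)
  \<comment> \<open>The boundary conditions make the forced labels at the end points agree with the sign of \<open>g\<close>.\<close>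
  have sgn0: "g (P x) (e i) \<le> 0" if "label x i = 0" "\<forall>i<m. x i \<le> p" "i < m" for x i
    using that low[OF P[OF that(2)] e_inv(1)[OF that(3)]] Pe[OF that(3)]
    by (auto simp: label_def split: if_splits)
  have sgn1: "g (P x) (e i) \<ge> 0" if "label x i \<noteq> 0" "\<forall>i<m. x i \<le> p" "i < m" for x i
    using that high[OF P[OF that(2)] e_inv(1)[OF that(3)]] Pe[OF that(3)]
    by (auto simp: label_def split: if_splits)
  have near: "\<bar>g (P q) (e i)\<bar> \<le> \<eta>" if i: "i < m" for i
  proof -
    obtain r s where rs: "\<forall>j<m. q j \<le> r j \<and> r j \<le> q j + 1" "\<forall>j<m. q j \<le> s j \<and> s j \<le> q j + 1"
        "label r i \<noteq> label s i"
      using q_cell i by blast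
    have le: "\<forall>j<m. x j \<le> p" if "\<forall>j<m. q j \<le> x j \<and> x j \<le> q j + 1" for x
      using that q by (metis Suc_eq_plus1 Suc_leI le_trans)
    have close: "\<bar>g (P q) (e i) - g (P x) (e i)\<bar> \<le> \<eta>" if "\<forall>j<m. q j \<le> x j \<and> x j \<le> q j + 1" for x
    proof (rule osc)
      show "P q \<in> N I p" by (rule P) (use q in \<open>auto intro: less_imp_le\<close>)
      show "P x \<in> N I p" by (rule P[OF le[OF that]])
      show "\<forall>j\<in>I. P q j \<le> P x j \<and> P x j \<le> P q j + 1"
        using that e'(1) by (simp add: P_def)
      show "e i \<in> I" using e_inv i by blast
    qed
    have "\<exists>x y. label x i = 0 \<and> label y i \<noteq> 0 \<and> (\<forall>j<m. q j \<le> x j \<and> x j \<le> q j + 1) \<and>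
        (\<forall>j<m. q j \<le> y j \<and> y j \<le> q j + 1)"
    proof (cases "label r i = 0")
      case True
      with rs show ?thesis by (intro exI[of _ r] exI[of _ s]) auto
    next
      case False
      then have "label s i = 0" using rs(3) by (auto simp: label_def split: if_splits)
      with False rs show ?thesis by (intro exI[of _ s] exI[of _ r]) auto
    qed
    then obtain x y where "label x i = 0" "label y i \<noteq> 0"
      and xy: "\<forall>j<m. q j \<le> x j \<and> x j \<le> q j + 1" "\<forall>j<m. q j \<le> y j \<and> y j \<le> q j + 1"
      by blast
    then have "g (P x) (e i) \<le> 0" "g (P y) (e i) \<ge> 0"
      using sgn0 sgn1 le i by blast+
    with close[OF xy(1)] close[OF xy(2)] show ?thesis by linarith
  qed
  have "P q \<in> N I p" by (rule P) (use q in \<open>auto intro: less_imp_le\<close>)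
  moreover have "\<forall>i\<in>I. \<bar>g (P q) i\<bar> \<le> \<eta>" using near e' by metis
  ultimately show ?thesis by blast
qed

section \<open>The Gorelik principle in \<open>c\<^sub>0\<close>\<close>

lemma c0_add: "x \<in> c0 \<Longrightarrow> y \<in> c0 \<Longrightarrow> x + y \<in> c0"
  and c0_diff: "x \<in> c0 \<Longrightarrow> y \<in> c0 \<Longrightarrow> x - y \<in> c0"
  and c0_scaleR: "x \<in> c0 \<Longrightarrow> r *\<^sub>R x \<in> c0"
  using tendsto_add[of x 0 sequentially y 0] tendsto_diff[of x 0 sequentially y 0]
    tendsto_scaleR[OF tendsto_const[of r], of x 0 sequentially]
  by (simp_all add: c0_def)

lemma convex_c0: "convex c0"
  by (simp add: convex_def c0_add c0_scaleR)

lemma c0_nonempty: "c0 \<noteq> {}"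
  by (auto simp: c0_def intro!: exI[of _ 0])

text \<open>
  The Gorelik principle. For \<open>a\<close> in a cube of the first \<open>n\<close> coordinates, the map
  \<open>a \<mapsto> U (V (w + a) + y) - w\<close> moves points by at most \<open>d\<close>, so by
  \<open>grid_map_near_zero\<close> the first \<open>n\<close> coordinates of some value \<open>z\<close> almost vanish; and then
  \<open>V (w + z) = V (w + a) + y\<close> by the choice of \<open>z\<close>. The modulus of continuity of this map is the
  same for all \<open>y\<close>, and therefore so is the finite grid \<open>G\<close>. The factor \<open>DIM('k) + 1\<close> accounts
  for a cube in real coordinates: its vectors have norm at most \<open>DIM('k) * d\<close>.
\<close>

lemma gorelik_principle_c0:
  fixes U :: "'a::real_normed_vector \<Rightarrow> nat \<Rightarrow>\<^sub>C 'k::{real_normed_field,euclidean_space}"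
  defines "V \<equiv> inv_into UNIV U"
  assumes bij: "bij_betw U UNIV c0"
    and ucU: "uniformly_continuous_on UNIV U" and ucV: "uniformly_continuous_on c0 V"
    and w: "w \<in> c0" and d: "d > 0" and \<eta>: "\<eta> > 0"
  obtains G where "finite G" "G \<subseteq> c0"
    "\<And>y. (\<And>x. dist (U (x + y)) (U x) \<le> d) \<Longrightarrow>
       \<exists>a\<in>G. \<exists>z\<in>c0. V (w + z) = V (w + a) + y \<and>
         norm z \<le> (real DIM('k) + 1) * d \<and> (\<forall>k<n. norm (apply_bcontfun z k) \<le> \<eta>)"
proof -
  have UV: "U (V v) = v" if "v \<in> c0" for v
    unfolding V_def using that bij by (metis bij_betw_imp_surj_on f_inv_into_f)
  have VU: "V (U x) = x" for x
    unfolding V_def using bij by (simp add: bij_betw_def)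
  have U_c0: "U x \<in> c0" for x
    using bij by (auto dest: bij_betwE)
  define \<eta>' where "\<eta>' = \<eta> / real DIM('k)"
  have \<eta>': "\<eta>' > 0" using \<eta> by (simp add: \<eta>'_def)
  obtain \<delta>1 where \<delta>1: "\<delta>1 > 0" "\<And>x x'. dist x x' < \<delta>1 \<Longrightarrow> dist (U x) (U x') < \<eta>'"
    using ucU \<eta>' unfolding uniformly_continuous_on_def by (metis UNIV_I)
  obtain \<delta>2 where \<delta>2: "\<delta>2 > 0" "\<And>v v'. v \<in> c0 \<Longrightarrow> v' \<in> c0 \<Longrightarrow> dist v v' < \<delta>2 \<Longrightarrow> dist (V v) (V v') < \<delta>1"
    using ucV \<delta>1(1) unfolding uniformly_continuous_on_def by metis
  \<comment> \<open>\<open>p\<close> is so large that moving every coordinate by one grid step changes \<open>U (V (w + a) + y)\<close>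
    by less than \<open>\<eta>'\<close>; the choice does not involve \<open>y\<close>.\<close>
  define p where "p = nat \<lceil>2 * real DIM('k) * d / \<delta>2\<rceil> + 1"
  have p: "p > 0" "real p > 2 * real DIM('k) * d / \<delta>2"
    unfolding p_def by simp linarith
  define I where "I = {..<n} \<times> (Basis :: 'k set)"
  define N where "N = PiE I (\<lambda>_. {..p})"
  define c where "c j = (2 * real j / real p - 1) * d" for j :: nat
  define a0 :: "(nat \<times> 'k \<Rightarrow> nat) \<Rightarrow> nat \<Rightarrow> 'k" where
    "a0 q k = (if k < n then \<Sum>b\<in>Basis. c (q (k, b)) *\<^sub>R b else 0)" for q k
  have "\<exists>x\<in>c0. apply_bcontfun x = a0 q" for q
  proof (rule tendsto_0_imp_c0)
    show "a0 q \<longlonglongrightarrow> 0"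
      by (rule tendsto_eventually) (auto simp: a0_def eventually_sequentially intro!: exI[of _ n])
  qed
  then obtain a where a: "\<And>q. a q \<in> c0" "\<And>q k. apply_bcontfun (a q) k = a0 q k"
    by metis
  have fin: "finite I" by (simp add: I_def)
  have a_coord: "a0 q k \<bullet> b = c (q (k, b))" if "k < n" "b \<in> Basis" for q k b
    using that by (simp add: a0_def)
  have c_bound: "\<bar>c j\<bar> \<le> d" if "j \<le> p" for j
  proof -
    have "0 \<le> real j / real p" "real j / real p \<le> 1" using that p(1) by auto
    then have "\<bar>2 * real j / real p - 1\<bar> \<le> 1" by linarith
    then show ?thesis using d by (simp add: c_def abs_mult mult_left_le_one_le)
  qed
  have norm_a: "norm (a q) \<le> real DIM('k) * d" if "q \<in> N" for q
  proof (rule norm_bound, unfold a(2))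
    fix k
    have "(\<Sum>b\<in>Basis. \<bar>a0 q k \<bullet> b\<bar>) \<le> real DIM('k) * d" if "k < n"
      using that \<open>q \<in> N\<close> by (intro sum_bounded_above) (auto simp: a_coord N_def I_def PiE_iff intro!: c_bound)
    then show "norm (a0 q k) \<le> real DIM('k) * d"
      using norm_le_l1[of "a0 q k"] d by (cases "k < n") (auto simp: a0_def)
  qed
  have dist_a: "dist (a q) (a r) < \<delta>2" if "q \<in> N" "r \<in> N" and qr: "\<forall>j\<in>I. q j \<le> r j \<and> r j \<le> q j + 1" for q r
  proof -
    have "norm (a q - a r) \<le> real DIM('k) * (2 * d / real p)"
    proof (rule norm_bound, unfold minus_bcontfun.rep_eq a(2))
      fix k
      have "(\<Sum>b\<in>Basis. \<bar>(a0 q k - a0 r k) \<bullet> b\<bar>) \<le> real DIM('k) * (2 * d / real p)" if k: "k < n"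
      proof (intro sum_bounded_above)
        fix b :: 'k assume b: "b \<in> Basis"
        have "(k, b) \<in> I" using k b by (simp add: I_def)
        with qr have "q (k, b) \<le> r (k, b) \<and> r (k, b) \<le> q (k, b) + 1" by blast
        then have "\<bar>real (q (k, b)) - real (r (k, b))\<bar> \<le> 1" by linarith
        moreover have "(a0 q k - a0 r k) \<bullet> b = (2 * d / real p) * (real (q (k, b)) - real (r (k, b)))"
          using k b using p(1) by (simp add: a_coord inner_diff_left c_def field_simps)
        ultimately show "\<bar>(a0 q k - a0 r k) \<bullet> b\<bar> \<le> 2 * d / real p"
          using d mult_left_mono[of "\<bar>real (q (k, b)) - real (r (k, b))\<bar>" 1 "2 * d / real p"]
          by (simp add: abs_mult)
      qed
      then show "norm (a0 q k - a0 r k) \<le> real DIM('k) * (2 * d / real p)"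
        using norm_le_l1[of "a0 q k - a0 r k"] d by (cases "k < n") (auto simp: a0_def)
    qed
    also have "\<dots> < \<delta>2"
      using p \<delta>2(1) by (simp add: field_simps)
    finally show ?thesis by (simp add: dist_norm)
  qed
  show ?thesis
  proof (rule that[of "a ` N"])
    show "finite (a ` N)" unfolding N_def using fin by (intro finite_imageI finite_PiE) auto
    show "a ` N \<subseteq> c0" using a by blast
    fix y assume y: "\<And>x. dist (U (x + y)) (U x) \<le> d"
    \<comment> \<open>\<open>\<phi>\<close> moves the grid vectors by at most \<open>d\<close>, so on the faces of the cube its coordinates have the
      signs that produce a near-zero.\<close>
    define \<phi> where "\<phi> q = U (V (w + a q) + y) - w" for q
    define g where "g q i = apply_bcontfun (\<phi> q) (fst i) \<bullet> snd i" for q and i :: "nat \<times> 'k"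
    have \<phi>_a: "norm (\<phi> q - a q) \<le> d" for q
      using y[of "V (w + a q)"] UV[OF c0_add[OF w a(1)]] by (simp add: \<phi>_def dist_norm algebra_simps)
    have g_near: "\<bar>g q (k, b) - c (q (k, b))\<bar> \<le> d" if "k < n" "b \<in> Basis" for q k b
    proof -
      have "g q (k, b) - c (q (k, b)) = apply_bcontfun (\<phi> q - a q) k \<bullet> b"
        using that by (simp add: g_def a inner_diff_left a_coord)
      also have "\<bar>\<dots>\<bar> \<le> norm (apply_bcontfun (\<phi> q - a q) k)"
        using Basis_le_norm[OF that(2)] by blast
      also have "\<dots> \<le> d" using norm_bounded[of "\<phi> q - a q" k] \<phi>_a[of q] by linarith
      finally show ?thesis .
    qed
    have "\<exists>q\<in>N. \<forall>i\<in>I. \<bar>g q i\<bar> \<le> \<eta>'"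
      unfolding N_def
    proof (rule grid_map_near_zero[OF fin p(1)], fold N_def)
      fix q i assume "q \<in> N" "i \<in> I" "q i = 0"
      then show "g q i \<le> 0" using g_near[of "fst i" "snd i" q] by (auto simp: I_def c_def)
    next
      fix q i assume "q \<in> N" "i \<in> I" "q i = p"
      then show "0 \<le> g q i" using g_near[of "fst i" "snd i" q] p(1) by (auto simp: I_def c_def)
    next
      fix q r i assume qr: "q \<in> N" "r \<in> N" "\<forall>j\<in>I. q j \<le> r j \<and> r j \<le> q j + 1" and "i \<in> I"
      have "dist (V (w + a q) + y) (V (w + a r) + y) < \<delta>1"
        using \<delta>2(2)[OF c0_add[OF w a(1)] c0_add[OF w a(1)], of q r] dist_a[OF qr] by simp
      then have "norm (\<phi> q - \<phi> r) < \<eta>'"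
        using \<delta>1(2) by (fastforce simp: \<phi>_def dist_norm)
      moreover have "\<bar>apply_bcontfun (\<phi> q - \<phi> r) (fst i) \<bullet> snd i\<bar> \<le> norm (apply_bcontfun (\<phi> q - \<phi> r) (fst i))"
        using \<open>i \<in> I\<close> by (intro Basis_le_norm) (auto simp: I_def)
      moreover have "\<dots> \<le> norm (\<phi> q - \<phi> r)" by (rule norm_bounded)
      ultimately show "\<bar>g q i - g r i\<bar> \<le> \<eta>'" by (simp add: g_def inner_diff_left)
    qed
    then obtain q where q: "q \<in> N" "\<And>i. i \<in> I \<Longrightarrow> \<bar>g q i\<bar> \<le> \<eta>'" by blast
    have "\<phi> q \<in> c0" using U_c0 w by (simp add: \<phi>_def c0_diff)
    moreover have "V (w + \<phi> q) = V (w + a q) + y" by (simp add: \<phi>_def VU)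
    moreover have "norm (\<phi> q) \<le> (real DIM('k) + 1) * d"
      using norm_triangle_ineq[of "\<phi> q - a q" "a q"] \<phi>_a[of q] norm_a[OF q(1)] by (simp add: algebra_simps)
    moreover have "norm (apply_bcontfun (\<phi> q) k) \<le> \<eta>" if "k < n" for k
    proof -
      have "(\<Sum>b\<in>Basis. \<bar>apply_bcontfun (\<phi> q) k \<bullet> b\<bar>) \<le> real DIM('k) * \<eta>'"
        using that q(2)[of "(k, _)"] by (intro sum_bounded_above) (auto simp: g_def I_def)
      then show ?thesis using norm_le_l1[of "apply_bcontfun (\<phi> q) k"] by (simp add: \<eta>'_def)
    qed
    ultimately show "\<exists>a\<in>a ` N. \<exists>z\<in>c0. V (w + z) = V (w + a) + y \<and>
         norm z \<le> (real DIM('k) + 1) * d \<and> (\<forall>k<n. norm (apply_bcontfun z k) \<le> \<eta>)"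
      using q(1) by blast
  qed
qed

text \<open>
  The form of the Gorelik principle for maps out of \<open>c\<^sub>0\<close> that survives composition with a linear
  surjection: at every scale \<open>s \<ge> t\<close>, each displacement \<open>g\<close> of the values with \<open>\<parallel>g\<parallel> \<le> c * s\<close> can be
  realised approximately by going from one of finitely many points \<open>w + a\<close> to a point \<open>w + z\<close> with
  \<open>z\<close> of norm at most \<open>s\<close> and almost supported on coordinates \<open>\<ge> n\<close>. That \<open>G\<close> precedes \<open>g\<close> is
  essential: later, \<open>g\<close> depends on a neighbourhood of an ordinal that is chosen in terms of \<open>G\<close>.
\<close>

definition gorelik_map ::
    "((nat \<Rightarrow>\<^sub>C 'k::{real_normed_field,euclidean_space}) \<Rightarrow> 'b::real_normed_vector) \<Rightarrow> real \<Rightarrow> real \<Rightarrow> bool" where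
  "gorelik_map F c t \<longleftrightarrow> (\<forall>w\<in>c0. \<forall>s n \<eta>. t \<le> s \<longrightarrow> 0 < s \<longrightarrow> 0 < \<eta> \<longrightarrow>
     (\<exists>G. finite G \<and> G \<subseteq> c0 \<and>
       (\<forall>g. norm g \<le> c * s \<longrightarrow>
         (\<exists>a\<in>G. \<exists>z\<in>c0. norm (F (w + z) - (F (w + a) + g)) \<le> \<eta> \<and>
           norm z \<le> s \<and> (\<forall>k<n. norm (apply_bcontfun z k) \<le> \<eta>)))))"

lemma gorelik_map_mono:
  fixes F :: "(nat \<Rightarrow>\<^sub>C 'k::{real_normed_field,euclidean_space}) \<Rightarrow> 'b::real_normed_vector"
  assumes F: "gorelik_map F c t" and t: "t \<le> t'"
  shows "gorelik_map F c t'"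
  unfolding gorelik_map_def
proof (intro ballI allI impI)
  fix w :: "nat \<Rightarrow>\<^sub>C 'k" and s \<eta> :: real and n
  assume "w \<in> c0" "t' \<le> s" "0 < s" "0 < \<eta>"
  then show "\<exists>G. finite G \<and> G \<subseteq> c0 \<and>
       (\<forall>g. norm g \<le> c * s \<longrightarrow>
         (\<exists>a\<in>G. \<exists>z\<in>c0. norm (F (w + z) - (F (w + a) + g)) \<le> \<eta> \<and>
           norm z \<le> s \<and> (\<forall>k<n. norm (apply_bcontfun z k) \<le> \<eta>)))"
    using F[unfolded gorelik_map_def, rule_format, of w s \<eta> n] t by simp
qed

text \<open>
  A displacement \<open>g\<close> is lifted approximately to \<open>y\<close> with \<open>\<parallel>y\<parallel> \<le> Q \<parallel>g\<parallel>\<close>, and translation by \<open>y\<close>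
  moves the values of \<open>U\<close> by at most \<open>L max {1, \<parallel>y\<parallel>}\<close>. This is at most \<open>d = s / \<kappa>\<close> if
  \<open>s \<ge> \<kappa> L\<close> and \<open>\<parallel>g\<parallel> \<le> s / (\<kappa> L Q)\<close>.
\<close>

lemma gorelik_principle_c0_quotient:
  fixes U :: "'a::real_normed_vector \<Rightarrow> nat \<Rightarrow>\<^sub>C 'k::{real_normed_field,euclidean_space}"
    and T :: "'a \<Rightarrow> 'b::real_normed_vector"
  defines "F \<equiv> \<lambda>v. T (inv_into UNIV U v)"
  assumes bij: "bij_betw U UNIV c0"
    and ucU: "uniformly_continuous_on UNIV U" and ucV: "uniformly_continuous_on c0 (inv_into UNIV U)"
    and T: "bounded_linear T" "surj T" "complete (UNIV :: 'b set)"
  obtains c t where "c > 0" "gorelik_map F c t"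
proof -
  interpret bounded_linear T by fact
  obtain L where L: "L > 0" "\<And>x x'. dist (U x) (U x') \<le> L * max 1 (dist x x')"
    using uniformly_continuous_on_convex_imp_large_scale_lipschitz[OF convex_UNIV ucU] by (metis UNIV_I)
  obtain Q where Q: "Q > 0" "\<And>z \<delta>. \<delta> > 0 \<Longrightarrow> \<exists>y. norm y \<le> Q * norm z \<and> norm (T y - z) \<le> \<delta>"
    using surj_bounded_linear_approx_lift[OF T] by metis
  define \<kappa> where "\<kappa> = real DIM('k) + 1"
  have \<kappa>: "\<kappa> > 0" by (simp add: \<kappa>_def add_nonneg_pos)
  show ?thesis
  proof (rule that[of "1 / (\<kappa> * L * Q)" "\<kappa> * L"])
    show "1 / (\<kappa> * L * Q) > 0" using \<kappa> L(1) Q(1) by simp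
    show "gorelik_map F (1 / (\<kappa> * L * Q)) (\<kappa> * L)"
      unfolding gorelik_map_def
    proof (intro ballI allI impI)
      fix w :: "nat \<Rightarrow>\<^sub>C 'k" and s \<eta> :: real and n
      assume w: "w \<in> c0" and s: "\<kappa> * L \<le> s" "0 < s" and \<eta>: "0 < \<eta>"
      define d where "d = s / \<kappa>"
      have d: "d > 0" "L \<le> d" "\<kappa> * d = s" using s \<kappa> by (simp_all add: d_def field_simps)
      obtain G where G: "finite G" "G \<subseteq> c0"
        "\<And>y. (\<And>x. dist (U (x + y)) (U x) \<le> d) \<Longrightarrow>
           \<exists>a\<in>G. \<exists>z\<in>c0. inv_into UNIV U (w + z) = inv_into UNIV U (w + a) + y \<and>
             norm z \<le> \<kappa> * d \<and> (\<forall>k<n. norm (apply_bcontfun z k) \<le> \<eta>)"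
        unfolding \<kappa>_def using gorelik_principle_c0[OF bij ucU ucV w d(1) \<eta>, where n = n] by blast
      have "\<exists>a\<in>G. \<exists>z\<in>c0. norm (F (w + z) - (F (w + a) + g)) \<le> \<eta> \<and>
              norm z \<le> s \<and> (\<forall>k<n. norm (apply_bcontfun z k) \<le> \<eta>)"
        if g: "norm g \<le> 1 / (\<kappa> * L * Q) * s" for g
      proof -
        obtain y where y: "norm y \<le> Q * norm g" "norm (T y - g) \<le> \<eta>" using Q(2)[OF \<eta>] by blast
        have "norm y \<le> Q * (1 / (\<kappa> * L * Q) * s)"
          using y(1) mult_left_mono[OF g, of Q] Q(1) by linarith
        also have "\<dots> = d / L" using Q(1) L(1) \<kappa> by (simp add: d_def field_simps)
        finally have "L * max 1 (norm y) \<le> d" using d(2) L(1) by (simp add: max_def field_simps)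
        then have "dist (U (x + y)) (U x) \<le> d" for x
          using L(2)[of "x + y" x] by (simp add: dist_norm)
        from G(3)[OF this] obtain a z where az: "a \<in> G" "z \<in> c0"
            "inv_into UNIV U (w + z) = inv_into UNIV U (w + a) + y"
            "norm z \<le> s" "\<forall>k<n. norm (apply_bcontfun z k) \<le> \<eta>"
          unfolding d(3) by blast
        have "F (w + z) - (F (w + a) + g) = T y - g" by (simp add: F_def az(3) add)
        with y(2) az show ?thesis by metis
      qed
      with G(1,2) show "\<exists>G. finite G \<and> G \<subseteq> c0 \<and>
           (\<forall>g. norm g \<le> 1 / (\<kappa> * L * Q) * s \<longrightarrow>
             (\<exists>a\<in>G. \<exists>z\<in>c0. norm (F (w + z) - (F (w + a) + g)) \<le> \<eta> \<and>
              norm z \<le> s \<and> (\<forall>k<n. norm (apply_bcontfun z k) \<le> \<eta>)))" by blast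
    qed
  qed
qed

section \<open>Slopes of functions at a given scale\<close>

text \<open>
  The least Lipschitz constant of \<open>f\<close> at scale \<open>t\<close>. Taking the maximum with \<open>t\<close> in the denominator,
  rather than restricting to pairs at distance at least \<open>t\<close>, yields a bound for all pairs of points.
\<close>

definition slope :: "'a::real_normed_vector set \<Rightarrow> ('a \<Rightarrow> real) \<Rightarrow> real \<Rightarrow> real" where
  "slope S f t = (SUP (u, v)\<in>S \<times> S. (f u - f v) / max t (norm (u - v)))"

context
  fixes S :: "'a::real_normed_vector set" and f :: "'a \<Rightarrow> real" and t C :: real
  assumes S: "S \<noteq> {}" and t: "t > 0"
    and lip: "\<And>u v. u \<in> S \<Longrightarrow> v \<in> S \<Longrightarrow> f u - f v \<le> C * max t (norm (u - v))"
begin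

lemma difference_quotient_le: "u \<in> S \<Longrightarrow> v \<in> S \<Longrightarrow> (f u - f v) / max t (norm (u - v)) \<le> C"
  using lip[of u v] t by (simp add: divide_le_eq)

lemma diff_le_slope:
  assumes "u \<in> S" "v \<in> S"
  shows "f u - f v \<le> slope S f t * max t (norm (u - v))"
proof -
  have "bdd_above ((\<lambda>(u, v). (f u - f v) / max t (norm (u - v))) ` (S \<times> S))"
    using difference_quotient_le by (intro bdd_aboveI[of _ C]) auto
  then have "(case (u, v) of (u, v) \<Rightarrow> (f u - f v) / max t (norm (u - v))) \<le> slope S f t"
    unfolding slope_def by (rule cSUP_upper[rotated]) (use assms in simp)
  then show ?thesis using t by (simp add: divide_le_eq)
qed

lemma slope_le: "slope S f t \<le> C"
  unfolding slope_def using S difference_quotient_le by (intro cSUP_least) auto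

lemma slope_nonneg: "0 \<le> slope S f t"
proof -
  obtain u where "u \<in> S" using S by blast
  then show ?thesis using diff_le_slope[of u u] t by (simp add: zero_le_mult_iff)
qed

lemma slope_almost_attained:
  assumes "\<epsilon> > 0"
  obtains u v where "u \<in> S" "v \<in> S" "(slope S f t - \<epsilon>) * max t (norm (u - v)) < f u - f v"
proof -
  obtain p where "p \<in> S \<times> S"
      "slope S f t - \<epsilon> < (case p of (u, v) \<Rightarrow> (f u - f v) / max t (norm (u - v)))"
    using less_cSUP_iff[of "S \<times> S" "\<lambda>(u, v). (f u - f v) / max t (norm (u - v))" "slope S f t - \<epsilon>"]
      S assms difference_quotient_le
    unfolding slope_def by (fastforce intro!: bdd_aboveI[of _ C])
  then obtain u v where "u \<in> S" "v \<in> S" "slope S f t - \<epsilon> < (f u - f v) / max t (norm (u - v))"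
    by auto
  then show ?thesis using t by (intro that[of u v]) (simp_all add: less_divide_eq)
qed

end

section \<open>Limit ordinals\<close>

text \<open>
  Ordinals whose Cantor normal form only has exponents \<open>\<ge> N + 1\<close> are limits of ordinals with
  exponents \<open>\<ge> N\<close>. If \<open>B < M\<close> and \<open>k\<close> is the largest exponent at which they differ, then dropping
  everything of \<open>M\<close> below \<open>k\<close>, replacing its coefficient at \<open>k\<close> by that of \<open>B\<close>, and adding one more
  copy of \<open>\<omega>\<^bsup>k-1\<^esup>\<close> than \<open>B\<close> has gives an ordinal strictly in between.
\<close>

lemma limit_ordinal_CNF:
  assumes "M \<noteq> {#}" "\<forall>j\<in>#M. Suc N \<le> j"
  shows "\<exists>\<^sub>F \<beta> in at (CNF M). \<exists>M'. \<beta> = CNF M' \<and> M' \<noteq> {#} \<and> (\<forall>j\<in>#M'. N \<le> j)"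
proof -
  have cofinal: "\<exists>M'. B < M' \<and> M' < M \<and> M' \<noteq> {#} \<and> (\<forall>j\<in>#M'. N \<le> j)" if less: "B < M" for B
  proof -
    obtain k where k: "count B k < count M k" "\<And>j. j > k \<Longrightarrow> count B j = count M j"
      using less unfolding less_multiset_iff_lex by blast
    then have "Suc N \<le> k" using assms(2) by (metis count_eq_zero_iff less_nat_zero_code)
    then obtain l where l: "k = Suc l" "N \<le> l" by (metis Suc_le_D Suc_le_mono)
    define M' where "M' = filter_mset (\<lambda>j. j > k) M + replicate_mset (count B k) k
        + replicate_mset (count B l + 1) l"
    have "B < M'"
      unfolding less_multiset_iff_lex
      by (rule exI[of _ l]) (auto simp: M'_def l(1) k(2)[unfolded l(1)])
    moreover have "M' < M"
      unfolding less_multiset_iff_lex using k(1) by (intro exI[of _ k]) (auto simp: M'_def l)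
    moreover have "N \<le> j" if "j \<in># M'" for j
      using that l by (auto simp: M'_def split: if_splits)
    ultimately show ?thesis by (intro exI[of _ M']) (auto simp: M'_def)
  qed
  have near: "\<exists>\<beta>\<in>W. \<beta> \<noteq> CNF M \<and> (\<exists>M'. \<beta> = CNF M' \<and> M' \<noteq> {#} \<and> (\<forall>j\<in>#M'. N \<le> j))"
    if W: "open W" "CNF M \<in> W" for W
  proof -
    have "CNF {#} < CNF M" using assms(1) by (metis le_multiset_empty_left less_ordww_simps(1) less_le)
    then obtain b where b: "b < CNF M" "{b<..CNF M} \<subseteq> W" using open_left[OF W] by blast
    then obtain B where B: "b = CNF B" by (cases b) auto
    with b cofinal[of B] obtain M' where "B < M'" "M' < M" "M' \<noteq> {#}" "\<forall>j\<in>#M'. N \<le> j" by auto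
    then show ?thesis using b(2) unfolding B by (intro bexI[of _ "CNF M'"]) auto
  qed
  show ?thesis
    unfolding frequently_def eventually_at_topological
  proof (rule notI, elim exE conjE)
    fix W assume "open W" "CNF M \<in> W"
      and avoid: "\<forall>\<beta>\<in>W. \<beta> \<noteq> CNF M \<longrightarrow> \<beta> \<in> UNIV \<longrightarrow> \<not> (\<exists>M'. \<beta> = CNF M' \<and> M' \<noteq> {#} \<and> (\<forall>j\<in>#M'. N \<le> j))"
    from near[OF this(1,2)] obtain \<beta> where "\<beta> \<in> W" "\<beta> \<noteq> CNF M"
        "\<exists>M'. \<beta> = CNF M' \<and> M' \<noteq> {#} \<and> (\<forall>j\<in>#M'. N \<le> j)"
      by (elim bexE conjE)
    with bspec[OF avoid this(1)] show False by simp
  qed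
qed

text \<open>
  Starting at \<open>\<omega>\<^sup>N\<close> one can move \<open>N\<close> times to a nearby ordinal, each time increasing \<open>A\<close> by \<open>e\<close>.
\<close>

lemma no_uniform_growth_at_limit_ordinals:
  fixes A :: "ordww \<Rightarrow> real"
  assumes e: "e > 0" and growth: "\<And>\<alpha>. \<forall>\<^sub>F \<beta> in at \<alpha>. A \<alpha> + e \<le> A \<beta>"
    and nonneg: "\<And>\<alpha>. 0 \<le> A \<alpha>" and bound: "\<And>\<alpha>. A \<alpha> \<le> K"
  shows False
proof -
  have "\<exists>\<beta>. A (CNF M) + real N * e \<le> A \<beta>" if "M \<noteq> {#}" "\<forall>j\<in>#M. N \<le> j" for N M
    using that
  proof (induction N arbitrary: M)
    case 0
    then show ?case by auto
  next
    case (Suc N)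
    obtain M' where "A (CNF M) + e \<le> A (CNF M')" "M' \<noteq> {#}" "\<forall>j\<in>#M'. N \<le> j"
      using frequently_ex[OF frequently_eventually_conj[OF limit_ordinal_CNF[OF Suc.prems] growth]]
      by auto
    moreover from this obtain \<beta> where "A (CNF M') + real N * e \<le> A \<beta>"
      using Suc.IH by blast
    ultimately have "A (CNF M) + real (Suc N) * e \<le> A \<beta>"
      by (simp add: algebra_simps)
    then show ?case by blast
  qed
  then have cofinal: "\<exists>\<beta>. A (CNF {#N#}) + real N * e \<le> A \<beta>" for N
    by simp
  have "real N * e \<le> K" for N
    using cofinal[of N] nonneg[of "CNF {#N#}"] bound by (meson add_increasing order_trans order_refl)
  moreover obtain N where "real N > K / e" using reals_Archimedean2 by blast
  ultimately show False using e by (metis not_le pos_divide_less_eq)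
qed

text \<open>
  Initial segments \<open>{..\<gamma>}\<close> are open and closed, because every \<open>\<gamma>\<close> below the maximum has
  an immediate successor \<open>\<gamma>'\<close>, so that the complement is \<open>{\<gamma>'..}\<close>.
\<close>

lemma exists_bcontfun_separating:
  fixes \<alpha> \<beta> :: ordww
  assumes "\<alpha> \<noteq> \<beta>" "0 \<le> r"
  obtains g :: "ordww \<Rightarrow>\<^sub>C 'k::real_normed_algebra_1" where
    "apply_bcontfun g \<alpha> = 0" "apply_bcontfun g \<beta> = of_real r" "norm g \<le> r"
proof -
  define \<gamma> where "\<gamma> = min \<alpha> \<beta>"
  define \<gamma>' where "\<gamma>' = (LEAST x. \<gamma> < x)"
  have "\<gamma> < max \<alpha> \<beta>" using assms(1) by (cases \<alpha> \<beta> rule: linorder_cases) (simp_all add: \<gamma>_def)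
  then have \<gamma>': "\<gamma> < x \<longleftrightarrow> \<gamma>' \<le> x" for x
    unfolding \<gamma>'_def by (meson LeastI Least_le less_le_trans)
  define p q :: 'k where "p = (if \<beta> \<le> \<gamma> then of_real r else 0)" and "q = (if \<beta> \<le> \<gamma> then 0 else of_real r)"
  define f where "f x = (if x \<le> \<gamma> then p else q)" for x
  have "continuous_on ({..\<gamma>} \<union> {\<gamma>'..}) f"
    unfolding f_def using \<gamma>' by (intro continuous_on_cases) (auto simp flip: not_less)
  moreover have "x \<le> \<gamma> \<or> \<gamma>' \<le> x" for x using \<gamma>'[of x] not_le by blast
  then have "{..\<gamma>} \<union> {\<gamma>'..} = (UNIV :: ordww set)" by auto
  ultimately have "f \<in> bcontfun" by (intro continuous_on_ordww_bcontfun) simp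
  then have f: "apply_bcontfun (Bcontfun f) = f" by (rule Bcontfun_inverse)
  show ?thesis
  proof (rule that[of "Bcontfun f"])
    show "apply_bcontfun (Bcontfun f) \<alpha> = 0" "apply_bcontfun (Bcontfun f) \<beta> = of_real r"
      using assms(1) by (auto simp: f f_def p_def q_def \<gamma>_def min_def)
    show "norm (Bcontfun f) \<le> r"
      using assms(2) by (intro norm_bound) (auto simp: f f_def p_def q_def)
  qed
qed

section \<open>Growth of slopes of point evaluations\<close>

lemma norm_add_le_if_almost_disjoint:
  fixes h z :: "nat \<Rightarrow>\<^sub>C 'k::real_normed_vector"
  assumes "norm h \<le> s" "norm z \<le> s" "\<forall>k\<ge>n. norm (apply_bcontfun h k) \<le> \<eta>"
    "\<forall>k<n. norm (apply_bcontfun z k) \<le> \<eta>"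
  shows "norm (h + z) \<le> s + \<eta>"
proof (rule norm_bound)
  fix k
  have "norm (apply_bcontfun h k) \<le> s" "norm (apply_bcontfun z k) \<le> s"
    using assms(1,2) norm_bounded order_trans by blast+
  moreover have "norm (apply_bcontfun h k) \<le> \<eta> \<or> norm (apply_bcontfun z k) \<le> \<eta>"
    using assms(3,4) by (cases "k < n") auto
  ultimately show "norm (apply_bcontfun (h + z) k) \<le> s + \<eta>"
    using norm_triangle_ineq[of "apply_bcontfun h k" "apply_bcontfun z k"] by auto
qed

text \<open>
  The scalar product with \<open>1\<close> is the real part of a scalar; it turns point evaluations into real
  functions, whose slopes can be compared.
\<close>

lemma abs_eval_diff_le:
  fixes x y :: "'b::topological_space \<Rightarrow>\<^sub>C 'k::{real_normed_field,euclidean_space}"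
  shows "\<bar>apply_bcontfun x \<beta> \<bullet> 1 - apply_bcontfun y \<beta> \<bullet> 1\<bar> \<le> norm (x - y)"
proof -
  have "\<bar>apply_bcontfun (x - y) \<beta> \<bullet> 1\<bar> \<le> norm (apply_bcontfun (x - y) \<beta>)"
    using Cauchy_Schwarz_ineq2[of "apply_bcontfun (x - y) \<beta>" 1] by simp
  also have "\<dots> \<le> norm (x - y)" by (rule norm_bounded)
  finally show ?thesis by (simp add: inner_diff_left)
qed

lemma eval_diff_le_of_large_scale_lipschitz:
  fixes F :: "'a::real_normed_vector \<Rightarrow> ('b::topological_space \<Rightarrow>\<^sub>C 'k::{real_normed_field,euclidean_space})"
  assumes C: "0 \<le> C" "\<And>u v. u \<in> S \<Longrightarrow> v \<in> S \<Longrightarrow> dist (F u) (F v) \<le> C * max 1 (dist u v)"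
    and uv: "u \<in> S" "v \<in> S" and t: "1 \<le> t"
  shows "apply_bcontfun (F u) \<beta> \<bullet> 1 - apply_bcontfun (F v) \<beta> \<bullet> 1 \<le> C * max t (norm (u - v))"
proof -
  have "apply_bcontfun (F u) \<beta> \<bullet> 1 - apply_bcontfun (F v) \<beta> \<bullet> 1 \<le> norm (F u - F v)"
    using abs_eval_diff_le by (rule order_trans[OF abs_ge_self])
  also have "\<dots> \<le> C * max 1 (norm (u - v))" using C(2)[OF uv] by (simp add: dist_norm)
  also have "\<dots> \<le> C * max t (norm (u - v))" using C(1) t by (intro mult_left_mono) auto
  finally show ?thesis .
qed

text \<open>
  The central estimate. Let \<open>u, v\<close> almost realise the slope of \<open>f \<alpha>\<close> at scale \<open>2 t\<close>, with midpoint
  \<open>w\<close>, and let \<open>w + z\<close> be the almost-midpoint from the Gorelik principle for a displacement of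
  size \<open>c * s\<close> at \<open>\<beta>\<close> and \<open>0\<close> at \<open>\<alpha>\<close>. Both halves of the segment have length at most about \<open>s\<close>.
  The slope of \<open>f \<alpha>\<close> bounds the decrease from \<open>u\<close> to \<open>w + z\<close>, so \<open>f \<alpha>\<close> has to decrease by
  almost the remaining half from \<open>w + z\<close> to \<open>v\<close>; there \<open>f \<beta>\<close> decreases by almost \<open>c * s\<close> more, because it
  almost agrees with \<open>f \<alpha>\<close> at \<open>v\<close> and at \<open>w + a\<close>.
\<close>

lemma slope_growth:
  fixes F :: "(nat \<Rightarrow>\<^sub>C 'k::{real_normed_field,euclidean_space}) \<Rightarrow> (ordww \<Rightarrow>\<^sub>C 'k)"
  defines "f \<equiv> \<lambda>\<beta> v. apply_bcontfun (F v) \<beta> \<bullet> 1"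
  assumes C: "0 \<le> C" "\<And>u v. u \<in> c0 \<Longrightarrow> v \<in> c0 \<Longrightarrow> dist (F u) (F v) \<le> C * max 1 (dist u v)"
    and c: "c > 0"
    and gorelik: "gorelik_map F c t"
    and t: "t \<ge> 1"
  shows "\<forall>\<^sub>F \<beta> in at \<alpha>. 2 * slope c0 (f \<alpha>) (2 * t) - slope c0 (f \<alpha>) t + c / 2 \<le> slope c0 (f \<beta>) t"
proof -
  have lip: "f \<beta> u - f \<beta> v \<le> C * max \<tau> (norm (u - v))" if "u \<in> c0" "v \<in> c0" "1 \<le> \<tau>" for \<beta> u v \<tau>
    unfolding f_def by (rule eval_diff_le_of_large_scale_lipschitz[OF C that])
  note ne = c0_nonempty
  have t0: "0 < t" using t by simp
  note slope_t = diff_le_slope[OF ne t0 lip[OF _ _ t]] slope_le[OF ne t0 lip[OF _ _ t]]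
  \<comment> \<open>The approximations below cost \<open>(6 + 2 * C) * \<epsilon> * s\<close> in total: two \<open>\<epsilon> * s\<close> from
    \<open>u, v\<close>, two from evaluating the displacement, two from comparing \<open>f \<alpha>\<close> with \<open>f \<beta>\<close>, and one
    \<open>C * \<epsilon> * s\<close> for the excess length of each half.\<close>
  define \<epsilon> where "\<epsilon> = c / (2 * (6 + 2 * C))"
  have \<epsilon>: "\<epsilon> > 0" "(6 + 2 * C) * \<epsilon> = c / 2" using c C(1) by (simp_all add: \<epsilon>_def field_simps)
  obtain u v where uv: "u \<in> c0" "v \<in> c0"
      "(slope c0 (f \<alpha>) (2 * t) - \<epsilon>) * max (2 * t) (norm (u - v)) < f \<alpha> u - f \<alpha> v"
    using slope_almost_attained[OF ne _ lip[where \<beta> = \<alpha> and \<tau> = "2 * t"] \<epsilon>(1)] t by auto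
  define s where "s = max (2 * t) (norm (u - v)) / 2"
  define w where "w = (1 / 2) *\<^sub>R (u + v)"
  define h where "h = (1 / 2) *\<^sub>R (u - v)"
  have s: "t \<le> s" "0 < s" "norm h \<le> s" "max (2 * t) (norm (u - v)) = 2 * s"
    using t by (auto simp: s_def h_def)
  have wh: "w + h = u" "w - h = v" "w \<in> c0" "h \<in> c0"
    using uv by (simp_all add: w_def h_def c0_add c0_diff c0_scaleR algebra_simps flip: scaleR_add_left)
  have \<epsilon>s: "\<epsilon> * s > 0" using \<epsilon> s by simp
  obtain n where n: "\<forall>k\<ge>n. norm (apply_bcontfun h k) \<le> \<epsilon> * s"
    using wh(4) \<epsilon>s unfolding c0_def lim_sequentially by (force simp: dist_norm intro: less_imp_le)
  obtain G where G: "finite G" "G \<subseteq> c0"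
      "\<And>g. norm g \<le> c * s \<Longrightarrow> \<exists>a\<in>G. \<exists>z\<in>c0. norm (F (w + z) - (F (w + a) + g)) \<le> \<epsilon> * s \<and>
            norm z \<le> s \<and> (\<forall>k<n. norm (apply_bcontfun z k) \<le> \<epsilon> * s)"
    using gorelik[unfolded gorelik_map_def, rule_format, OF wh(3) s(1,2) \<epsilon>s, of n] by metis
  have near: "\<forall>\<^sub>F \<beta> in at \<alpha>. \<bar>f \<beta> x - f \<alpha> x\<bar> < \<epsilon> * s" for x
  proof -
    have "(apply_bcontfun (F x) \<longlongrightarrow> apply_bcontfun (F x) \<alpha>) (at \<alpha>)"
      using continuous_on_apply_bcontfun[of UNIV "F x"] by (simp add: continuous_on_def)
    then have "((\<lambda>\<beta>. f \<beta> x) \<longlongrightarrow> f \<alpha> x) (at \<alpha>)"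
      unfolding f_def by (intro tendsto_inner tendsto_const)
    then show ?thesis using \<epsilon>s by (auto simp: tendsto_iff dist_real_def)
  qed
  have "\<forall>\<^sub>F \<beta> in at \<alpha>. \<beta> \<noteq> \<alpha> \<and> \<bar>f \<beta> v - f \<alpha> v\<bar> < \<epsilon> * s \<and>
          (\<forall>a\<in>G. \<bar>f \<beta> (w + a) - f \<alpha> (w + a)\<bar> < \<epsilon> * s)"
    using near G(1) by (intro eventually_conj eventually_neq_at_within eventually_ball_finite) auto
  then show ?thesis
  proof eventually_elim
    case (elim \<beta>)
    obtain g :: "ordww \<Rightarrow>\<^sub>C 'k" where g: "apply_bcontfun g \<alpha> = 0"
        "apply_bcontfun g \<beta> = of_real (c * s)" "norm g \<le> c * s"
      using exists_bcontfun_separating[of \<alpha> \<beta> "c * s"] elim c s(2) by auto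
    obtain a z where az: "a \<in> G" "z \<in> c0" "norm (F (w + z) - (F (w + a) + g)) \<le> \<epsilon> * s"
        "norm z \<le> s" "\<forall>k<n. norm (apply_bcontfun z k) \<le> \<epsilon> * s"
      using G(3)[OF g(3)] by blast
    have "\<bar>f \<gamma> (w + z) - (f \<gamma> (w + a) + apply_bcontfun g \<gamma> \<bullet> 1)\<bar> \<le> \<epsilon> * s" for \<gamma>
      using abs_eval_diff_le[of "F (w + z)" \<gamma> "F (w + a) + g"] az(3)
      by (simp add: f_def inner_add_left)
    from this[of \<alpha>] this[of \<beta>]
    have jump: "f \<alpha> (w + z) \<le> f \<alpha> (w + a) + \<epsilon> * s" "f \<beta> (w + a) + c * s - \<epsilon> * s \<le> f \<beta> (w + z)"
      by (simp_all add: g of_real_def inner_scaleR_left dot_square_norm)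
    have eq: "u - (w + z) = h + (- z)" "w + z - v = h + z"
      using wh(1,2) by (simp_all add: algebra_simps)
    have "norm (u - (w + z)) \<le> s + \<epsilon> * s" "norm (w + z - v) \<le> s + \<epsilon> * s"
      using norm_add_le_if_almost_disjoint[OF s(3) _ n, of "- z"]
        norm_add_le_if_almost_disjoint[OF s(3) _ n, of z] az(4,5) unfolding eq by simp_all
    then have mx: "max t (norm (u - (w + z))) \<le> s + \<epsilon> * s" "max t (norm (w + z - v)) \<le> s + \<epsilon> * s"
      using s(1) \<epsilon>s by auto
    have upper: "f \<gamma> x - f \<gamma> y \<le> slope c0 (f \<gamma>) t * s + C * (\<epsilon> * s)"
      if "x \<in> c0" "y \<in> c0" "max t (norm (x - y)) \<le> s + \<epsilon> * s" for x y \<gamma>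
    proof -
      have "f \<gamma> x - f \<gamma> y \<le> slope c0 (f \<gamma>) t * max t (norm (x - y))"
        by (rule slope_t(1)[OF _ _ that(1,2)])
      also have "\<dots> \<le> slope c0 (f \<gamma>) t * (s + \<epsilon> * s)"
        using that(3) slope_nonneg[OF ne t0 lip[OF _ _ t]] by (intro mult_left_mono) auto
      also have "\<dots> \<le> slope c0 (f \<gamma>) t * s + C * (\<epsilon> * s)"
        using slope_t(2)[of \<gamma>] \<epsilon>s by (simp add: distrib_left mult_right_mono)
      finally show ?thesis .
    qed
    have wz: "w + z \<in> c0" using wh(3) az(2) by (rule c0_add)
    have "f \<beta> (w + z) - f \<beta> v \<le> slope c0 (f \<beta>) t * s + C * (\<epsilon> * s)"
      using upper[OF wz uv(2) mx(2)] .
    moreover have "f \<alpha> u - f \<alpha> (w + z) \<le> slope c0 (f \<alpha>) t * s + C * (\<epsilon> * s)"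
      using upper[OF uv(1) wz mx(1)] .
    moreover have "(slope c0 (f \<alpha>) (2 * t) - \<epsilon>) * (2 * s) < f \<alpha> u - f \<alpha> v"
      using uv(3) s(4) by simp
    moreover have "\<bar>f \<beta> v - f \<alpha> v\<bar> < \<epsilon> * s" "\<bar>f \<beta> (w + a) - f \<alpha> (w + a)\<bar> < \<epsilon> * s"
      using elim az(1) by auto
    ultimately have "(2 * slope c0 (f \<alpha>) (2 * t) - slope c0 (f \<alpha>) t + c - (6 + 2 * C) * \<epsilon>) * s
        \<le> slope c0 (f \<beta>) t * s"
      using jump by (simp add: algebra_simps)
    then have "2 * slope c0 (f \<alpha>) (2 * t) - slope c0 (f \<alpha>) t + c - (6 + 2 * C) * \<epsilon> \<le> slope c0 (f \<beta>) t"
      using s(2) by simp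
    then show ?case unfolding \<epsilon>(2) by simp
  qed
qed

text \<open>
  Summing \<open>slope_growth\<close> over the scales \<open>2\<^sup>k t\<close> with \<open>k < M\<close>, the terms
  \<open>2 (S \<alpha> (k + 1) - S \<alpha> k)\<close> telescope to at least \<open>- 2 C\<close>, while the gains add up to \<open>M c / 2\<close>.
  For large \<open>M\<close> the sum of the slopes therefore increases by \<open>1\<close> near every ordinal.
\<close>

lemma no_gorelik_map_into_continuous_functions_on_ordww:
  fixes F :: "(nat \<Rightarrow>\<^sub>C 'k::{real_normed_field,euclidean_space}) \<Rightarrow> (ordww \<Rightarrow>\<^sub>C 'k)"
  assumes C: "0 \<le> C" "\<And>u v. u \<in> c0 \<Longrightarrow> v \<in> c0 \<Longrightarrow> dist (F u) (F v) \<le> C * max 1 (dist u v)"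
    and c: "c > 0" and gorelik: "gorelik_map F c t0"
  shows False
proof -
  define f where "f \<beta> v = apply_bcontfun (F v) \<beta> \<bullet> 1" for \<beta> v
  have lip: "f \<beta> u - f \<beta> v \<le> C * max \<tau> (norm (u - v))" if "u \<in> c0" "v \<in> c0" "1 \<le> \<tau>" for \<beta> u v \<tau>
    unfolding f_def by (rule eval_diff_le_of_large_scale_lipschitz[OF C that])
  define t where "t = max 1 t0"
  define S where "S \<beta> k = slope c0 (f \<beta>) (2 ^ k * t)" for \<beta> and k :: nat
  have scale: "1 \<le> 2 ^ k * t" "t0 \<le> 2 ^ k * t" for k :: nat
  proof -
    have "1 * t \<le> 2 ^ k * t" by (intro mult_right_mono) (auto simp: t_def)
    then show "1 \<le> 2 ^ k * t" "t0 \<le> 2 ^ k * t" by (auto simp: t_def)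
  qed
  have S_bounds: "0 \<le> S \<beta> k" "S \<beta> k \<le> C" for \<beta> k
    unfolding S_def
    using scale(1)[of k] slope_nonneg[OF c0_nonempty _ lip[OF _ _ scale(1)]]
      slope_le[OF c0_nonempty _ lip[OF _ _ scale(1)]] by simp_all
  obtain M :: nat where "(2 * C + 1) * 2 / c < real M" using reals_Archimedean2 by blast
  then have M: "2 * C + 1 \<le> real M * (c / 2)" using c by (simp add: field_simps)
  define A where "A \<beta> = (\<Sum>k<M. S \<beta> k)" for \<beta>
  have growth: "\<forall>\<^sub>F \<beta> in at \<alpha>. A \<alpha> + 1 \<le> A \<beta>" for \<alpha>
  proof -
    have map: "gorelik_map F c (2 ^ k * t)" for k :: nat
      using gorelik scale(2) by (rule gorelik_map_mono)
    have step: "\<forall>\<^sub>F \<beta> in at \<alpha>. 2 * S \<alpha> (Suc k) - S \<alpha> k + c / 2 \<le> S \<beta> k" for k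
      using slope_growth[OF C c map[of k] scale(1)[of k], of \<alpha>] unfolding S_def f_def
      by (simp add: mult.assoc)
    have "\<forall>\<^sub>F \<beta> in at \<alpha>. \<forall>k\<in>{..<M}. 2 * S \<alpha> (Suc k) - S \<alpha> k + c / 2 \<le> S \<beta> k"
      using step by (intro eventually_ball_finite) auto
    then show ?thesis
    proof eventually_elim
      case (elim \<beta>)
      have "(\<Sum>k<M. S \<alpha> k + 2 * (S \<alpha> (Suc k) - S \<alpha> k) + c / 2) \<le> A \<beta>"
        unfolding A_def using elim by (intro sum_mono) (simp add: algebra_simps)
      then have "A \<alpha> + 2 * (S \<alpha> M - S \<alpha> 0) + real M * (c / 2) \<le> A \<beta>"
        unfolding sum.distrib sum_distrib_left[symmetric] sum_lessThan_telescope by (simp add: A_def)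
      with M S_bounds(1)[of \<alpha> M] S_bounds(2)[of \<alpha> 0] show ?case by (simp add: algebra_simps)
    qed
  qed
  have "0 \<le> A \<alpha>" "A \<alpha> \<le> real M * C" for \<alpha>
    unfolding A_def using S_bounds sum_bounded_above[of "{..<M}" "S \<alpha>" C] by (auto intro: sum_nonneg)
  with growth show False
    using no_uniform_growth_at_limit_ordinals[of 1 A "real M * C"] by simp
qed

theorem theorem3p1:
  fixes scaleX :: "'k::{real_normed_field,euclidean_space} \<Rightarrow> 'a::banach \<Rightarrow> 'a"
  assumes "normed_space_over scaleX"
    and "has_quotient_space scaleX
           (scale_bcontfun :: 'k \<Rightarrow> (ordww \<Rightarrow>\<^sub>C 'k) \<Rightarrow> (ordww \<Rightarrow>\<^sub>C 'k))"
  shows "\<not> uniformly_homeomorphic (UNIV :: 'a set) (c0 :: (nat \<Rightarrow>\<^sub>C 'k) set)"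
proof
  assume "uniformly_homeomorphic (UNIV :: 'a set) (c0 :: (nat \<Rightarrow>\<^sub>C 'k) set)"
  then obtain U :: "'a \<Rightarrow> nat \<Rightarrow>\<^sub>C 'k" where U: "bij_betw U UNIV c0" "uniformly_continuous_on UNIV U"
      "uniformly_continuous_on c0 (inv_into UNIV U)"
    unfolding uniformly_homeomorphic_def by blast
  obtain T :: "'a \<Rightarrow> ordww \<Rightarrow>\<^sub>C 'k" where T: "bounded_linear T" "surj T"
    using assms(2) unfolding has_quotient_space_def by blast
  define F where "F v = T (inv_into UNIV U v)" for v
  have "uniformly_continuous_on c0 F"
    unfolding F_def by (rule bounded_linear.uniformly_continuous_on[OF T(1) U(3)])
  then obtain C where "C > 0"
      "\<And>u v. u \<in> c0 \<Longrightarrow> v \<in> c0 \<Longrightarrow> dist (F u) (F v) \<le> C * max 1 (dist u v)"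
    using uniformly_continuous_on_convex_imp_large_scale_lipschitz[OF convex_c0] by metis
  moreover obtain c t where "c > 0" "gorelik_map F c t"
    using gorelik_principle_c0_quotient[OF U T complete_UNIV_bcontfun] unfolding F_def by blast
  ultimately show False
    by (intro no_gorelik_map_into_continuous_functions_on_ordww[of C F c t]) auto
qed

end
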